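(* Let $F$ be a field of characteristic zero, let $n\ge 1$, and for each $s\in\{1,\dots,n\}$ let $i_{s1}<i_{s2}<\cdots<i_{sm_s}$ be fixed positive integers. Then the Lie algebra $W(n,i^* )$ over $F$ is simple.
   Context: $N$ denotes the non-negative integers and $Z$ the integers. $F_{n,i^*}$ is the commutative associative $F$-algebra $F[e^{\pm x_1^{i_{11}}},\dots,e^{\pm x_1^{i_{1m_1}}},x_1^{\pm1},\dots,e^{\pm x_n^{i_{n1}}},\dots,e^{\pm x_n^{i_{nm_n}}},x_n^{\pm1}]$, in which the symbols $e^{x_s^{i_{sk}}}$ and $x_s$ are algebraically independent invertible generators, with $F$-basis the monomials $\prod_{s=1}^n\left(\prod_{k=1}^{m_s}e^{a_{sk}x_s^{i_{sk}}}\right)x_s^{j_s}$, $a_{sk},j_s\in Z$, where $e^{a x_s^{i}}:=(e^{x_s^{i}})^a$. For $t\in\{1,\dots,n\}$, $\partial_t$ is the usual partial derivative with respect to $x_t$, i.e. the $F$-derivation with $\partial_t(x_s)=\delta_{st}$ and $\partial_t(e^{x_s^{i_{sk}}})=\delta_{st}\,i_{sk}x_s^{i_{sk}-1}e^{x_s^{i_{sk}}}$. $W(n,i^* )$ is the Lie algebra over $F$ with basis $$\left\{\prod_{s=1}^n\left(\prod_{k=1}^{m_s}e^{a_{sk}x_s^{i_{sk}}}\right)x_1^{j_1}\cdots x_n^{j_n}\,\partial_t \;:\; a_{sk}\in Z,\ j_1,\dots,j_n\in N,\ t\in\{1,\dots,n\}\right\}$$ and bracket $[f\partial_p,g\partial_q]=f\,\partial_p(g)\,\partial_q-g\,\partial_q(f)\,\partial_p$.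 *)

theory Defs
  imports Complex_Main "HOL-Library.Poly_Mapping" "HOL-Library.Product_Plus"
begin

(* Lie algebras whose carrier L is a subspace of an ambient vector space *)

locale lie_algebra = vector_space scale
  for scale :: "'a::field \<Rightarrow> 'v::ab_group_add \<Rightarrow> 'v" +
  fixes L :: "'v set" and br :: "'v \<Rightarrow> 'v \<Rightarrow> 'v"
  assumes subspace_carrier: "subspace L"
    and br_closed: "x \<in> L \<Longrightarrow> y \<in> L \<Longrightarrow> br x y \<in> L"
    and br_add_left: "x \<in> L \<Longrightarrow> y \<in> L \<Longrightarrow> z \<in> L \<Longrightarrow> br (x + y) z = br x z + br y z"
    and br_add_right: "x \<in> L \<Longrightarrow> y \<in> L \<Longrightarrow> z \<in> L \<Longrightarrow> br x (y + z) = br x y + br x z"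
    and br_scale_left: "x \<in> L \<Longrightarrow> y \<in> L \<Longrightarrow> br (scale c x) y = scale c (br x y)"
    and br_scale_right: "x \<in> L \<Longrightarrow> y \<in> L \<Longrightarrow> br x (scale c y) = scale c (br x y)"
    and br_self: "x \<in> L \<Longrightarrow> br x x = 0"
    and jacobi: "x \<in> L \<Longrightarrow> y \<in> L \<Longrightarrow> z \<in> L \<Longrightarrow>
      br x (br y z) + br y (br z x) + br z (br x y) = 0"
begin

definition lie_ideal :: "'v set \<Rightarrow> bool" where
  "lie_ideal I \<longleftrightarrow> subspace I \<and> I \<subseteq> L \<and> (\<forall>x\<in>L. \<forall>y\<in>I. br x y \<in> I)"

end

locale simple_lie_algebra = lie_algebra scale L br
  for scale :: "'a::field \<Rightarrow> 'v::ab_group_add \<Rightarrow> 'v" and L br +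
  assumes nonabelian: "\<exists>x\<in>L. \<exists>y\<in>L. br x y \<noteq> 0"
    and ideal_trivial: "lie_ideal I \<Longrightarrow> I = {0} \<or> I = L"

(* The commutative algebra in the independent invertible generators x_s and
   e^(x_s^(i s k)), as the group algebra of its group of monomials.  The pair (a, j)
   stands for the monomial in which e^(x_s^(i s k)) has exponent a (s, k) and x_s has
   exponent j s.  Generators are available for all natural numbers s and k; the algebra
   with s in {1..n} and k in {1..m s} is the subalgebra that they generate. *)

type_synonym monom = "((nat \<times> nat) \<Rightarrow>\<^sub>0 int) \<times> (nat \<Rightarrow>\<^sub>0 int)"
type_synonym 'a exp_alg = "monom \<Rightarrow>\<^sub>0 'a"

definition x_pow :: "nat \<Rightarrow> int \<Rightarrow> 'a::field exp_alg" where
  "x_pow s j = Poly_Mapping.single (0, Poly_Mapping.single s j) 1"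

definition e_pow :: "nat \<Rightarrow> nat \<Rightarrow> int \<Rightarrow> 'a::field exp_alg" where
  "e_pow s k a = Poly_Mapping.single (Poly_Mapping.single (s, k) a, 0) 1"

definition alg_scale :: "'a::field \<Rightarrow> 'a exp_alg \<Rightarrow> 'a exp_alg" where
  "alg_scale c = Poly_Mapping.map ((*) c)"

(* The partial derivative of a monomial (a, j) with respect to x_t is
     j t * x_t^(-1) * (a, j)
       + (sum over k in {1..m t} of a (t, k) * i t k * x_t^(i t k - 1)) * (a, j). *)

definition pd_monom ::
  "(nat \<Rightarrow> nat) \<Rightarrow> (nat \<Rightarrow> nat \<Rightarrow> nat) \<Rightarrow> nat \<Rightarrow> monom \<Rightarrow> 'a::field exp_alg" where
  "pd_monom m i t \<mu> =
     (alg_scale (of_int (Poly_Mapping.lookup (snd \<mu>) t)) (x_pow t (-1))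
       + (\<Sum>k=1..m t. alg_scale (of_int (Poly_Mapping.lookup (fst \<mu>) (t, k)) * of_nat (i t k))
                        (x_pow t (int (i t k) - 1))))
     * Poly_Mapping.single \<mu> 1"

definition pd ::
  "(nat \<Rightarrow> nat) \<Rightarrow> (nat \<Rightarrow> nat \<Rightarrow> nat) \<Rightarrow> nat \<Rightarrow> 'a::field exp_alg \<Rightarrow> 'a exp_alg" where
  "pd m i t f =
     (\<Sum>\<mu>\<in>Poly_Mapping.keys f. alg_scale (Poly_Mapping.lookup f \<mu>) (pd_monom m i t \<mu>))"

(* Vector fields: the element f * d/dx_t is Poly_Mapping.single t f. *)

type_synonym 'a vfield = "nat \<Rightarrow>\<^sub>0 'a exp_alg"

definition vf_scale :: "'a::field \<Rightarrow> 'a vfield \<Rightarrow> 'a vfield" where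
  "vf_scale c = Poly_Mapping.map (alg_scale c)"

definition vf_bracket ::
  "(nat \<Rightarrow> nat) \<Rightarrow> (nat \<Rightarrow> nat \<Rightarrow> nat) \<Rightarrow> 'a::field vfield \<Rightarrow> 'a vfield \<Rightarrow> 'a vfield" where
  "vf_bracket m i u v =
     (\<Sum>p\<in>Poly_Mapping.keys u. \<Sum>q\<in>Poly_Mapping.keys v.
        Poly_Mapping.single q (Poly_Mapping.lookup u p * pd m i p (Poly_Mapping.lookup v q))
      - Poly_Mapping.single p (Poly_Mapping.lookup v q * pd m i q (Poly_Mapping.lookup u p)))"

definition W_basis :: "nat \<Rightarrow> (nat \<Rightarrow> nat) \<Rightarrow> 'a::field vfield set" where
  "W_basis n m =
     {Poly_Mapping.single t
        ((\<Prod>s=1..n. \<Prod>k=1..m s. e_pow s k (a s k)) * (\<Prod>s=1..n. x_pow s (int (j s))))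
      | (a :: nat \<Rightarrow> nat \<Rightarrow> int) (j :: nat \<Rightarrow> nat) t. t \<in> {1..n}}"

definition W :: "nat \<Rightarrow> (nat \<Rightarrow> nat) \<Rightarrow> 'a::field vfield set" where
  "W n m = module.span vf_scale (W_basis n m)"

(* Checks of the definitions above: pd m i t is a linear derivation with the expected
   values on the generators, and the bracket is given by the usual formula. *)

lemma lookup_alg_scale [simp]:
  "Poly_Mapping.lookup (alg_scale c f) \<mu> = c * Poly_Mapping.lookup f \<mu>"
  by (simp add: alg_scale_def Poly_Mapping.map.rep_eq when_def)

lemma alg_scale_eq_mult: "alg_scale c f = Poly_Mapping.single 0 c * f"
  by (simp add: alg_scale_def mult_map_scale_conv_mult)

lemma pd_superset:
  assumes "finite S" "Poly_Mapping.keys f \<subseteq> S"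
  shows "pd m i t f = (\<Sum>\<mu>\<in>S. alg_scale (Poly_Mapping.lookup f \<mu>) (pd_monom m i t \<mu>))"
  unfolding pd_def
  by (rule sum.mono_neutral_left)
     (use assms in \<open>auto simp: in_keys_iff alg_scale_eq_mult\<close>)

lemma pd_zero [simp]: "pd m i t 0 = 0"
  by (simp add: pd_def)

lemma pd_add: "pd m i t (f + g) = pd m i t f + pd m i t g"
proof -
  let ?S = "Poly_Mapping.keys f \<union> Poly_Mapping.keys g"
  have S: "finite ?S" "Poly_Mapping.keys (f + g) \<subseteq> ?S"
    by (auto dest: subsetD[OF Poly_Mapping.keys_add])
  show ?thesis
    by (simp add: pd_superset[OF S] pd_superset[of ?S f] pd_superset[of ?S g]
        alg_scale_eq_mult lookup_add single_add distrib_right sum.distrib)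
qed

lemma pd_scale: "pd m i t (alg_scale c f) = alg_scale c (pd m i t f)"
proof -
  have S: "finite (Poly_Mapping.keys f)"
    "Poly_Mapping.keys (alg_scale c f) \<subseteq> Poly_Mapping.keys f"
    by (auto simp: in_keys_iff)
  have *: "alg_scale (c * d) h = alg_scale c (alg_scale d h)" for d and h :: "'a exp_alg"
    by (rule poly_mapping_eqI) simp
  have "alg_scale c (pd m i t f) =
      (\<Sum>\<mu>\<in>Poly_Mapping.keys f.
         alg_scale c (alg_scale (Poly_Mapping.lookup f \<mu>) (pd_monom m i t \<mu>)))"
    by (simp add: pd_def alg_scale_eq_mult sum_distrib_left)
  then show ?thesis
    by (simp add: pd_superset[OF S] *)
qed

lemma pd_single: "pd m i t (Poly_Mapping.single \<mu> c) = alg_scale c (pd_monom m i t \<mu>)"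
  by (subst pd_superset[of "{\<mu>}"]) auto

lemma pd_monom_add:
  "pd_monom m i t (\<mu> + \<nu>) =
     (Poly_Mapping.single \<mu> 1 * pd_monom m i t \<nu> + pd_monom m i t \<mu> * Poly_Mapping.single \<nu> 1
        :: 'a::field exp_alg)"
proof -
  have *: "Poly_Mapping.single (\<mu> + \<nu>) (1::'a) =
      Poly_Mapping.single \<mu> 1 * Poly_Mapping.single \<nu> 1"
    by (simp add: mult_single)
  show ?thesis
    unfolding pd_monom_def *
    by (simp add: alg_scale_eq_mult lookup_add single_add distrib_right distrib_left
        sum.distrib sum_distrib_left sum_distrib_right mult_ac add_ac)
qed

lemma exp_alg_induct [case_names zero single add]:
  fixes f :: "'a::field exp_alg"
  assumes "P 0" "\<And>\<mu> c. P (Poly_Mapping.single \<mu> c)" "\<And>f g. P f \<Longrightarrow> P g \<Longrightarrow> P (f + g)"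
  shows "P f"
proof -
  have "P (\<Sum>\<mu>\<in>A. Poly_Mapping.single \<mu> (Poly_Mapping.lookup f \<mu>))" if "finite A" for A
    using that by induction (auto intro: assms)
  moreover have "f = (\<Sum>\<mu>\<in>Poly_Mapping.keys f. Poly_Mapping.single \<mu> (Poly_Mapping.lookup f \<mu>))"
    by (rule poly_mapping_eqI) (auto simp: lookup_sum lookup_single when_def in_keys_iff)
  ultimately show ?thesis
    by (metis finite_keys)
qed

lemma pd_mult: "pd m i t (f * g) = f * pd m i t g + pd m i t f * g"
proof (induction f rule: exp_alg_induct)
  case (single \<mu> c)
  show ?case
  proof (induction g rule: exp_alg_induct)
    case (single \<nu> d)
    have 1: "Poly_Mapping.single \<mu> c = Poly_Mapping.single 0 c * Poly_Mapping.single \<mu> 1"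
      and 2: "Poly_Mapping.single \<nu> d = Poly_Mapping.single 0 d * Poly_Mapping.single \<nu> 1"
      and 3: "Poly_Mapping.single (0::monom) (c * d) =
        Poly_Mapping.single 0 c * Poly_Mapping.single 0 d"
      by (simp_all add: mult_single)
    have "pd m i t (Poly_Mapping.single \<mu> c * Poly_Mapping.single \<nu> d) =
        Poly_Mapping.single 0 (c * d) * pd_monom m i t (\<mu> + \<nu>)"
      by (simp add: mult_single pd_single alg_scale_eq_mult)
    then show ?case
      unfolding pd_single alg_scale_eq_mult pd_monom_add 3
      by (subst 1, subst 2) (simp add: algebra_simps)
  qed (simp_all add: pd_add algebra_simps)
qed (simp_all add: pd_add algebra_simps)

lemma pd_x: "pd m i t (x_pow s 1) = (if s = t then 1 else 0)"
  unfolding x_pow_def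
  by (auto simp: pd_single pd_monom_def x_pow_def alg_scale_eq_mult mult_single lookup_single
      when_def single_uminus zero_prod_def[symmetric] simp flip: single_add)

lemma pd_e:
  assumes "k \<in> {1..m s}"
  shows "pd m i t (e_pow s k 1) =
    (if s = t then alg_scale (of_nat (i s k)) (x_pow s (int (i s k) - 1) * e_pow s k 1) else 0)"
proof -
  have "(\<Sum>k'=1..m t. alg_scale (of_int (if s = t \<and> k' = k then 1 else 0) * of_nat (i t k'))
           (x_pow t (int (i t k') - 1))) =
        (\<Sum>k'=1..m t. if k' = k then
           (if s = t then alg_scale (of_nat (i s k)) (x_pow s (int (i s k) - 1)) else 0)
           else (0 :: 'a exp_alg))"
    by (rule sum.cong) (auto simp: alg_scale_eq_mult)
  also have "\<dots> = (if s = t then alg_scale (of_nat (i s k)) (x_pow s (int (i s k) - 1)) else 0)"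
    using assms by (cases "s = t") simp_all
  finally show ?thesis
    unfolding e_pow_def
    by (auto simp: pd_single pd_monom_def lookup_single when_def alg_scale_eq_mult mult.assoc)
qed

lemma vf_bracket_single:
  "vf_bracket m i (Poly_Mapping.single p f) (Poly_Mapping.single q g) =
     Poly_Mapping.single q (f * pd m i p g) - Poly_Mapping.single p (g * pd m i q f)"
  by (cases "f = 0"; cases "g = 0") (simp_all add: vf_bracket_def)

lemma vector_space_vf_scale: "vector_space (vf_scale :: 'a::field \<Rightarrow> _)"
proof -
  have *: "Poly_Mapping.lookup (vf_scale c u) t = Poly_Mapping.single 0 c * Poly_Mapping.lookup u t"
    for c :: 'a and u t
    by (simp add: vf_scale_def Poly_Mapping.map.rep_eq when_def alg_scale_eq_mult)
  show ?thesis
    by unfold_locales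
      (rule poly_mapping_eqI, simp add: * lookup_add single_add algebra_simps mult_single
         flip: mult.assoc)+
qed

end

theory Submission
  imports Defs
begin

text \<open>
  Write \<open>A\<close> for the algebra \<open>coeff_alg\<close> of coefficients, so that \<open>W n m\<close> is the free \<open>A\<close>-module on the commuting
  derivations \<open>\<partial>\<^sub>1, \<dots>, \<partial>\<^sub>n\<close>. A vector field is determined by the derivation of \<open>A\<close> that it induces, its
  bracket is computed by applying each of the two fields to the components of the other
  (\<open>lookup_vf_bracket\<close>), and this gives the Lie algebra axioms. Simplicity rests on two facts.

  First, \<open>A\<close> has no proper nonzero ideal that is stable under all \<open>\<partial>\<^sub>t\<close> (\<open>one_in_pd_stable_ideal\<close>).
  An element of \<open>A\<close> is a sum of terms \<open>p \<cdot> e\<close> with \<open>p\<close> a polynomial in the \<open>x\<^sub>s\<close> and \<open>e\<close> an exponential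
  monomial. Exponential monomials are units, so one of them may be moved to \<open>1\<close>; its
  polynomial loses degree under differentiation, and when it disappears the number of exponential
  monomials has dropped. The descent can only stop at an element killed by every \<open>\<partial>\<^sub>t\<close>, and such an
  element is a constant (\<open>pd_kernel\<close>).

  Second, a nonzero ideal \<open>I\<close> of \<open>W n m\<close> can be cut down to single components. For fixed \<open>p\<close> and \<open>x = x\<^sub>p\<close>,
  the fields \<open>\<partial>\<^sub>p, x\<partial>\<^sub>p, x\<^sup>2\<partial>\<^sub>p\<close> span a copy of \<open>sl\<^sub>2\<close>. Its Casimir operator
  \<open>ad \<partial>\<^sub>p \<circ> ad x\<^sup>2\<partial>\<^sub>p - 2 (ad x\<partial>\<^sub>p)\<^sup>2 + ad x\<^sup>2\<partial>\<^sub>p \<circ> ad \<partial>\<^sub>p\<close> kills all components other than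
  the \<open>p\<close>-th, since there the three fields act as on functions, and multiplies the \<open>p\<close>-th by \<open>-4\<close>.
  Hence \<open>I\<close> contains \<open>h\<partial>\<^sub>p\<close> for some \<open>p\<close> and some \<open>h \<noteq> 0\<close> (\<open>component_in_ideal\<close>).

  The two facts are joined as follows. Writing \<open>'\<close> for \<open>\<partial>\<^sub>p\<close>, if \<open>k\<partial>\<^sub>p\<close> and \<open>xk\<partial>\<^sub>p\<close> lie in \<open>I\<close>, then so does \<open>bk\<partial>\<^sub>p\<close> for every
  \<open>b\<close> in \<open>A\<close> (\<open>ideal_part_absorbs\<close>), and \<open>k = h''\<close> has this property. Choosing \<open>h\<close> with \<open>h'' \<noteq> 0\<close>, the elements \<open>g\<close> with
  \<open>gA\<partial>\<^sub>p \<subseteq> I\<close> form a nonzero \<open>\<partial>\<close>-stable ideal of \<open>A\<close>, which is therefore \<open>A\<close>.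
  So \<open>A\<partial>\<^sub>p \<subseteq> I\<close>, and bracketing with \<open>x\<^sub>p\<partial>\<^sub>q\<close> yields \<open>A\<partial>\<^sub>q \<subseteq> I\<close> for all \<open>q\<close>.
\<close>

abbreviation (input) keys :: "('b \<Rightarrow>\<^sub>0 'c::zero) \<Rightarrow> 'b set" where
  "keys \<equiv> Poly_Mapping.keys"

abbreviation (input) lookup :: "('b \<Rightarrow>\<^sub>0 'c::zero) \<Rightarrow> 'b \<Rightarrow> 'c" where
  "lookup \<equiv> Poly_Mapping.lookup"

abbreviation (input) single :: "'b \<Rightarrow> 'c \<Rightarrow> ('b \<Rightarrow>\<^sub>0 'c::zero)" where
  "single \<equiv> Poly_Mapping.single"

section \<open>The commuting partial derivatives\<close>

lemma lookup_single_mult: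
  fixes f :: "'a::field exp_alg"
  shows "lookup (single \<mu> c * f) \<nu> = c * lookup f (\<nu> - \<mu>)"
proof (induction f rule: exp_alg_induct)
  case (single \<xi> d)
  have "\<mu> + \<xi> = \<nu> \<longleftrightarrow> \<xi> = \<nu> - \<mu>"
    by (auto simp: algebra_simps)
  then show ?case
    by (simp add: mult_single lookup_single when_def)
qed (simp_all add: lookup_add distrib_left)

text \<open>Reading off one coefficient of a derivative: \<open>x\<^sub>t\<close>-differentiation never mixes different exponential
  monomials \<open>a\<close>. The first summand lowers the exponent of \<open>x\<^sub>t\<close> by one, the others raise it by
  \<open>i t k - 1\<close>.\<close>

lemma lookup_pd:
  fixes f :: "'a::field exp_alg"
  shows "lookup (pd m i t f) (a, j) =
    of_int (lookup j t + 1) * lookup f (a, j + single t 1)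
    + (\<Sum>k=1..m t. of_int (lookup a (t, k)) * of_nat (i t k)
         * lookup f (a, j - single t (int (i t k) - 1)))"
proof (induction f rule: exp_alg_induct)
  case (single \<mu> c)
  obtain b l where \<mu>: "\<mu> = (b, l)" by (cases \<mu>)
  have xp: "lookup (x_pow t e :: 'a exp_alg) ((a, j) - (b, l)) =
      (if a = b \<and> l = j - single t e then 1 else 0)" for e
    by (auto simp: x_pow_def lookup_single when_def algebra_simps)
  have "lookup (pd m i t (single \<mu> c)) (a, j) = c *
      (of_int (lookup l t) * lookup (x_pow t (- 1)) ((a, j) - (b, l))
       + (\<Sum>k=1..m t. of_int (lookup b (t, k)) * of_nat (i t k)
            * lookup (x_pow t (int (i t k) - 1)) ((a, j) - (b, l))))"
    by (simp add: pd_single pd_monom_def \<mu> mult.commute[of _ "single _ _"] lookup_single_mult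
        lookup_add lookup_sum)
  also have "of_int (lookup l t) * lookup (x_pow t (- 1) :: 'a exp_alg) ((a, j) - (b, l)) =
      of_int (lookup j t + 1) * lookup (single (b, l) 1) (a, j + single t 1)"
    unfolding xp by (auto simp: lookup_single when_def single_uminus lookup_add)
  also have "(\<Sum>k=1..m t. of_int (lookup b (t, k)) * of_nat (i t k)
            * lookup (x_pow t (int (i t k) - 1) :: 'a exp_alg) ((a, j) - (b, l))) =
      (\<Sum>k=1..m t. of_int (lookup a (t, k)) * of_nat (i t k)
            * lookup (single (b, l) 1) (a, j - single t (int (i t k) - 1)))"
    unfolding xp by (rule sum.cong) (auto simp: lookup_single when_def)
  finally have "lookup (pd m i t (single \<mu> c)) (a, j) = c *
      (of_int (lookup j t + 1) * lookup (single (b, l) 1) (a, j + single t 1)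
       + (\<Sum>k=1..m t. of_int (lookup a (t, k)) * of_nat (i t k)
            * lookup (single (b, l) 1) (a, j - single t (int (i t k) - 1))))" .
  moreover have "lookup (single \<mu> c) \<nu> = c * lookup (single (b, l) 1) \<nu>" for \<nu>
    by (simp add: \<mu> lookup_single when_def)
  ultimately show ?case
    by (simp only: distrib_left sum_distrib_left mult_ac)
qed (simp_all add: pd_add lookup_add distrib_left sum.distrib)

lemma lookup_numeral_mult:
  fixes f :: "'a::field exp_alg"
  shows "lookup (numeral k * f) \<mu> = numeral k * lookup f \<mu>"
  by (simp add: lookup_single_mult flip: single_numeral)

lemma numeral_mult_eq_0:
  fixes f :: "'a::field_char_0 exp_alg"
  assumes "numeral k * f = 0"
  shows "f = 0"
proof (rule poly_mapping_eqI)
  fix \<mu>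
  have "numeral k * lookup f \<mu> = lookup (numeral k * f) \<mu>"
    by (simp only: lookup_numeral_mult)
  with assms show "lookup f \<mu> = lookup 0 \<mu>" by simp
qed

lemma pd_one [simp]: "pd m i t 1 = 0"
  by (simp add: pd_single pd_monom_def alg_scale_eq_mult lookup_single flip: single_one)

lemma pd_uminus: "pd m i t (- f) = - pd m i t f"
  by (metis add.inverse_unique add.right_inverse pd_add pd_zero)

lemma pd_numeral [simp]: "pd m i t (numeral k) = 0"
  by (simp add: pd_single pd_monom_def alg_scale_eq_mult lookup_single flip: single_numeral)

lemma pd_diff: "pd m i t (f - g) = pd m i t f - pd m i t g"
  by (metis diff_conv_add_uminus pd_add pd_uminus)

lemma pd_sum: "pd m i t (sum f S) = (\<Sum>x\<in>S. pd m i t (f x))"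
  by (induction S rule: infinite_finite_induct) (simp_all add: pd_add)

lemma pd_x_pow_other: "p \<noteq> q \<Longrightarrow> pd m i p (x_pow q e) = 0"
  by (simp add: x_pow_def pd_single pd_monom_def alg_scale_eq_mult lookup_single when_def)

text \<open>On a monomial, \<open>pd m i t\<close> is multiplication by a logarithmic derivative that only involves \<open>x\<^sub>t\<close>, so the
  logarithmic derivative for \<open>q\<close> is a constant with respect to \<open>x\<^sub>p\<close> when \<open>p \<noteq> q\<close>.\<close>

lemma pd_commute:
  fixes f :: "'a::field exp_alg"
  shows "pd m i p (pd m i q f) = pd m i q (pd m i p f)"
proof (cases "p = q")
  case False
  show ?thesis
  proof (induction f rule: exp_alg_induct)
    case (single \<mu> c)
    have other: "pd m i p (x_pow q e) = 0" "pd m i q (x_pow p e) = 0" for e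
      using False by (simp_all add: pd_x_pow_other)
    have monom: "pd_monom m i t \<mu> = pd m i t (single \<mu> 1)" for t
      by (simp add: pd_single alg_scale_eq_mult)
    have "pd m i p (pd_monom m i q \<mu> :: 'a exp_alg) = pd m i q (pd_monom m i p \<mu>)"
      by (simp add: pd_monom_def pd_mult pd_add pd_sum pd_scale other monom[symmetric])
         (simp add: pd_monom_def alg_scale_eq_mult algebra_simps)
    then show ?case
      by (simp add: pd_single pd_scale)
  qed (simp_all add: pd_add)
qed simp

section \<open>Vector fields as derivations\<close>

lemma alg_scale_zero [simp]: "alg_scale c 0 = 0"
  by (simp add: alg_scale_eq_mult)

lemma lookup_vf_scale [simp]: "lookup (vf_scale c u) t = alg_scale c (lookup u t)"
  by (simp add: vf_scale_def Poly_Mapping.map.rep_eq when_def)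

text \<open>The derivation that a vector field induces. Through it the bracket becomes the commutator of
  derivations, so that bilinearity and the Jacobi identity hold for all vector fields.\<close>

definition vf_apply ::
  "(nat \<Rightarrow> nat) \<Rightarrow> (nat \<Rightarrow> nat \<Rightarrow> nat) \<Rightarrow> 'a::field vfield \<Rightarrow> 'a exp_alg \<Rightarrow> 'a exp_alg" where
  "vf_apply m i u g = (\<Sum>p\<in>keys u. lookup u p * pd m i p g)"

lemma vf_apply_superset:
  "finite S \<Longrightarrow> keys u \<subseteq> S \<Longrightarrow> vf_apply m i u g = (\<Sum>p\<in>S. lookup u p * pd m i p g)"
  unfolding vf_apply_def by (rule sum.mono_neutral_left) (auto simp: in_keys_iff)

lemma vf_apply_add_left: "vf_apply m i (u + v) g = vf_apply m i u g + vf_apply m i v g"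
proof -
  have S: "finite (keys u \<union> keys v)" "keys (u + v) \<subseteq> keys u \<union> keys v"
    by (auto dest: subsetD[OF Poly_Mapping.keys_add])
  show ?thesis
    by (simp add: vf_apply_superset[OF S] vf_apply_superset[OF S(1), of u]
        vf_apply_superset[OF S(1), of v] lookup_add distrib_right sum.distrib)
qed

lemma vf_apply_scale_left: "vf_apply m i (vf_scale c u) g = alg_scale c (vf_apply m i u g)"
proof -
  have S: "finite (keys u)" "keys (vf_scale c u) \<subseteq> keys u"
    by (auto simp: in_keys_iff)
  show ?thesis
    by (simp add: vf_apply_superset[OF S])
      (simp add: vf_apply_def alg_scale_eq_mult sum_distrib_left mult.assoc)
qed

lemma vf_apply_single: "vf_apply m i (single p f) g = f * pd m i p g"
  by (subst vf_apply_superset[of "{p}"]) auto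

lemma vf_apply_zero_right [simp]: "vf_apply m i u 0 = 0"
  by (simp add: vf_apply_def)

lemma vf_apply_add_right: "vf_apply m i u (f + g) = vf_apply m i u f + vf_apply m i u g"
  by (simp add: vf_apply_def pd_add distrib_left sum.distrib)

lemma vf_apply_diff_right: "vf_apply m i u (f - g) = vf_apply m i u f - vf_apply m i u g"
  by (simp add: vf_apply_def pd_diff right_diff_distrib sum_subtractf)

lemma vf_apply_scale_right: "vf_apply m i u (alg_scale c f) = alg_scale c (vf_apply m i u f)"
  by (simp add: vf_apply_def pd_scale) (simp add: alg_scale_eq_mult sum_distrib_left mult_ac)

lemma vf_apply_mult: "vf_apply m i u (f * g) = f * vf_apply m i u g + vf_apply m i u f * g"
  by (simp add: vf_apply_def pd_mult distrib_left distrib_right sum.distrib sum_distrib_left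
      sum_distrib_right mult_ac)

lemma lookup_vf_bracket:
  fixes u v :: "'a::field vfield"
  shows "lookup (vf_bracket m i u v) q = vf_apply m i u (lookup v q) - vf_apply m i v (lookup u q)"
proof -
  have pick: "(\<Sum>x\<in>keys w. lookup (single x (F x)) q) = F q"
    if "F q = 0 \<or> q \<in> keys w" for w :: "'a vfield" and F :: "nat \<Rightarrow> 'a exp_alg"
  proof (cases "q \<in> keys w")
    case True
    have "(\<Sum>x\<in>keys w. lookup (single x (F x)) q) = (\<Sum>x\<in>keys w. if x = q then F x else 0)"
      by (rule sum.cong) (auto simp: lookup_single when_def)
    with True show ?thesis by simp
  next
    case False
    then show ?thesis using that
      by (auto intro!: sum.neutral simp: lookup_single when_def)
  qed
  have "lookup (vf_bracket m i u v) q =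
      (\<Sum>p\<in>keys u. \<Sum>x\<in>keys v. lookup (single x (lookup u p * pd m i p (lookup v x))) q)
      - (\<Sum>x\<in>keys v. \<Sum>p\<in>keys u. lookup (single p (lookup v x * pd m i x (lookup u p))) q)"
    by (simp add: vf_bracket_def lookup_sum lookup_minus sum_subtractf) (rule sum.swap)
  also have "(\<Sum>p\<in>keys u. \<Sum>x\<in>keys v. lookup (single x (lookup u p * pd m i p (lookup v x))) q)
      = vf_apply m i u (lookup v q)"
    unfolding vf_apply_def by (intro sum.cong refl pick) (auto simp: in_keys_iff)
  also have "(\<Sum>x\<in>keys v. \<Sum>p\<in>keys u. lookup (single p (lookup v x * pd m i x (lookup u p))) q)
      = vf_apply m i v (lookup u q)"
    unfolding vf_apply_def by (intro sum.cong refl pick) (auto simp: in_keys_iff)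
  finally show ?thesis .
qed

text \<open>In the commutator of the two derivations the second-order terms \<open>u\<^sub>p v\<^sub>q \<partial>\<^sub>p \<partial>\<^sub>q g\<close> cancel because the
  partial derivatives commute.\<close>

lemma vf_apply_bracket:
  fixes u v :: "'a::field vfield"
  shows "vf_apply m i (vf_bracket m i u v) g =
     vf_apply m i u (vf_apply m i v g) - vf_apply m i v (vf_apply m i u g)"
proof -
  let ?S = "keys u \<union> keys v \<union> keys (vf_bracket m i u v)"
  have S: "finite ?S" and sub: "keys u \<subseteq> ?S" "keys v \<subseteq> ?S" by auto
  have sup: "vf_apply m i w g = (\<Sum>p\<in>?S. lookup w p * pd m i p g)" if "keys w \<subseteq> ?S" for w :: "'a vfield" and g
    using vf_apply_superset[OF S that] .
  have second: "vf_apply m i w (vf_apply m i z g) =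
      (\<Sum>q\<in>?S. vf_apply m i w (lookup z q) * pd m i q g)
      + (\<Sum>q\<in>?S. \<Sum>p\<in>?S. lookup w p * lookup z q * pd m i p (pd m i q g))"
    if "keys w \<subseteq> ?S" "keys z \<subseteq> ?S" for w z :: "'a vfield"
  proof -
    have sum: "vf_apply m i w (sum f T) = (\<Sum>x\<in>T. vf_apply m i w (f x))" for f and T :: "nat set"
      by (induction T rule: infinite_finite_induct) (simp_all add: vf_apply_add_right)
    have "vf_apply m i w (vf_apply m i z g) =
        (\<Sum>q\<in>?S. lookup z q * vf_apply m i w (pd m i q g) + vf_apply m i w (lookup z q) * pd m i q g)"
      by (simp only: sup[OF that(2), of g] sum vf_apply_mult)
    also have "\<dots> = (\<Sum>q\<in>?S. \<Sum>p\<in>?S. lookup w p * lookup z q * pd m i p (pd m i q g))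
        + (\<Sum>q\<in>?S. vf_apply m i w (lookup z q) * pd m i q g)"
      by (simp only: sup[OF that(1), of "pd m i _ g"] sum.distrib sum_distrib_left mult_ac)
    finally show ?thesis by (simp only: add.commute)
  qed
  have "(\<Sum>q\<in>?S. \<Sum>p\<in>?S. lookup u p * lookup v q * pd m i p (pd m i q g)) =
      (\<Sum>q\<in>?S. \<Sum>p\<in>?S. lookup v p * lookup u q * pd m i p (pd m i q g))"
    by (subst sum.swap) (simp only: pd_commute[of m i _ _ g] mult_ac)
  then have "vf_apply m i u (vf_apply m i v g) - vf_apply m i v (vf_apply m i u g) =
      (\<Sum>q\<in>?S. vf_apply m i u (lookup v q) * pd m i q g)
      - (\<Sum>q\<in>?S. vf_apply m i v (lookup u q) * pd m i q g)"
    by (simp only: second[OF sub] second[OF sub(2,1)]) simp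
  also have "\<dots> = vf_apply m i (vf_bracket m i u v) g"
    by (subst sup) (auto simp: lookup_vf_bracket left_diff_distrib sum_subtractf)
  finally show ?thesis ..
qed

lemma vf_bracket_jacobi:
  "vf_bracket m i x (vf_bracket m i y z) + vf_bracket m i y (vf_bracket m i z x)
     + vf_bracket m i z (vf_bracket m i x y) = 0"
  by (rule poly_mapping_eqI)
     (simp add: lookup_add lookup_vf_bracket vf_apply_bracket vf_apply_diff_right)


lemma vf_scale_single: "vf_scale c (single p f) = single p (alg_scale c f)"
  by (rule poly_mapping_eqI) (simp add: lookup_single when_def)

interpretation vf: vector_space "vf_scale :: 'a::field \<Rightarrow> 'a vfield \<Rightarrow> 'a vfield"
  by (rule vector_space_vf_scale)

section \<open>The coefficient algebra\<close>

lemma sum_single_lookup: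
  assumes "finite S" "keys f \<subseteq> S"
  shows "(\<Sum>x\<in>S. single x (lookup f x)) = f"
proof (rule poly_mapping_eqI)
  fix y
  have "lookup (\<Sum>x\<in>S. single x (lookup f x)) y = (\<Sum>x\<in>S. if x = y then lookup f x else 0)"
    by (auto simp: lookup_sum lookup_single when_def intro!: sum.cong)
  then show "lookup (\<Sum>x\<in>S. single x (lookup f x)) y = lookup f y"
    using assms by (auto simp: in_keys_iff)
qed

lemma prod_single:
  "(\<Prod>x\<in>S. single (\<mu> x) 1 :: 'a::field exp_alg) = single (\<Sum>x\<in>S. \<mu> x) 1"
  by (induction S rule: infinite_finite_induct) (simp_all add: mult_single)

locale exp_generators =
  fixes n :: nat and m :: "nat \<Rightarrow> nat" and i :: "nat \<Rightarrow> nat \<Rightarrow> nat"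
  assumes i_pos: "\<And>s k. s \<in> {1..n} \<Longrightarrow> k \<in> {1..m s} \<Longrightarrow> i s k > 0"
    and i_strict_mono: "\<And>s. s \<in> {1..n} \<Longrightarrow> strict_mono_on {1..m s} (i s)"
begin

definition monoms :: "monom set" where
  "monoms = {(a, j). keys a \<subseteq> (SIGMA s:{1..n}. {1..m s}) \<and> keys j \<subseteq> {1..n} \<and> (\<forall>s. 0 \<le> lookup j s)}"

definition coeff_alg :: "'a::field exp_alg set" where
  "coeff_alg = {f. keys f \<subseteq> monoms}"

lemma monoms_zero [simp]: "0 \<in> monoms"
  by (simp add: monoms_def zero_prod_def)

lemma monoms_add:
  assumes "\<mu> \<in> monoms" "\<nu> \<in> monoms"
  shows "\<mu> + \<nu> \<in> monoms"
proof -
  obtain a j b l where "\<mu> = (a, j)" "\<nu> = (b, l)" by (cases \<mu>, cases \<nu>)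
  moreover have "keys (a + b) \<subseteq> keys a \<union> keys b" "keys (j + l) \<subseteq> keys j \<union> keys l"
    by (rule Poly_Mapping.keys_add)+
  ultimately show ?thesis
    using assms unfolding monoms_def by (simp add: lookup_add) blast
qed

lemma monoms_shift:
  assumes "(a, j) \<in> monoms" "t \<in> {1..n}" "0 \<le> lookup j t + e"
  shows "(a, j + single t e) \<in> monoms"
proof -
  have "keys (j + single t e) \<subseteq> keys j \<union> {t}"
    using Poly_Mapping.keys_add[of j "single t e"] by (auto split: if_splits)
  with assms show ?thesis
    by (auto simp: monoms_def lookup_add lookup_single when_def)
qed

lemma coeff_alg_single: "\<mu> \<in> monoms \<Longrightarrow> single \<mu> c \<in> coeff_alg"
  by (simp add: coeff_alg_def)

lemma coeff_alg_zero [simp]: "0 \<in> coeff_alg"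
  by (simp add: coeff_alg_def)

lemma coeff_alg_one [simp]: "1 \<in> coeff_alg"
  unfolding single_one[symmetric] by (rule coeff_alg_single) simp

lemma coeff_alg_add: "f \<in> coeff_alg \<Longrightarrow> g \<in> coeff_alg \<Longrightarrow> f + g \<in> coeff_alg"
  using Poly_Mapping.keys_add[of f g] by (auto simp: coeff_alg_def)

lemma coeff_alg_scale: "f \<in> coeff_alg \<Longrightarrow> alg_scale c f \<in> coeff_alg"
  by (auto simp: coeff_alg_def in_keys_iff)

lemma coeff_alg_uminus: "f \<in> coeff_alg \<Longrightarrow> - f \<in> coeff_alg"
  by (auto simp: coeff_alg_def)

lemma coeff_alg_diff: "f \<in> coeff_alg \<Longrightarrow> g \<in> coeff_alg \<Longrightarrow> f - g \<in> coeff_alg"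
  using coeff_alg_add[of f "- g"] by (simp add: coeff_alg_uminus)

lemma coeff_alg_sum: "(\<And>x. x \<in> S \<Longrightarrow> f x \<in> coeff_alg) \<Longrightarrow> sum f S \<in> coeff_alg"
  by (induction S rule: infinite_finite_induct) (auto intro: coeff_alg_add)

lemma coeff_alg_mult: "f \<in> coeff_alg \<Longrightarrow> g \<in> coeff_alg \<Longrightarrow> f * g \<in> coeff_alg"
  using keys_mult[of f g] monoms_add by (fastforce simp: coeff_alg_def)

lemma coeff_alg_x_pow: "t \<in> {1..n} \<Longrightarrow> 0 \<le> e \<Longrightarrow> x_pow t e \<in> coeff_alg"
  unfolding x_pow_def using monoms_shift[of 0 0 t e] coeff_alg_single by (simp add: zero_prod_def[symmetric])

text \<open>Differentiation can produce no negative exponent: the term that lowers the exponent of \<open>x\<^sub>t\<close> carries that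
  exponent as a factor, and \<open>i t k - 1\<close> is nonnegative.\<close>

lemma coeff_alg_pd:
  assumes "f \<in> coeff_alg" "t \<in> {1..n}"
  shows "pd m i t f \<in> coeff_alg"
  unfolding coeff_alg_def
proof (clarify, rename_tac a j)
  fix a j
  assume "(a, j) \<in> keys (pd m i t f)"
  then have "lookup (pd m i t f) (a, j) \<noteq> 0"
    by (simp add: in_keys_iff)
  then consider "of_int (lookup j t + 1) * lookup f (a, j + single t 1) \<noteq> 0"
    | k where "k \<in> {1..m t}" "lookup f (a, j - single t (int (i t k) - 1)) \<noteq> 0"
    unfolding lookup_pd by (metis (no_types, lifting) add_0 mult_zero_right sum.neutral)
  then show "(a, j) \<in> monoms"
  proof cases
    case 1
    then have in_monoms: "(a, j + single t 1) \<in> monoms"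
      using assms(1) by (auto simp: coeff_alg_def in_keys_iff)
    moreover have "lookup j t + 1 \<noteq> 0"
      using 1 by (metis mult_zero_left of_int_0)
    moreover have "0 \<le> lookup j t + 1"
      using in_monoms by (auto simp: monoms_def lookup_add lookup_single dest: spec[of _ t])
    ultimately show ?thesis
      using monoms_shift[OF in_monoms assms(2), of "-1"]
      by (simp add: lookup_add single_uminus)
  next
    case 2
    then have in_monoms: "(a, j - single t (int (i t k) - 1)) \<in> monoms"
      using assms(1) by (auto simp: coeff_alg_def in_keys_iff)
    then have "0 \<le> lookup (j - single t (int (i t k) - 1)) t"
      by (auto simp: monoms_def)
    then show ?thesis
      using monoms_shift[OF in_monoms assms(2), of "int (i t k) - 1"] i_pos[OF assms(2) 2(1)]
      by (simp add: lookup_minus)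
  qed
qed

section \<open>Differential simplicity of the coefficient algebra\<close>

text \<open>If an exponential monomial \<open>a\<close> of \<open>f\<close> involves \<open>x\<^sub>t\<close>, let \<open>K\<close> be the largest index with a nonzero exponent
  \<open>a (t, K)\<close>. As the \<open>i t k\<close> increase with \<open>k\<close>, the term of highest degree in \<open>x\<^sub>t\<close> that goes with \<open>a\<close> in the derivative
  comes from \<open>K\<close> alone; it does not vanish in characteristic zero. So there are no exponentials, and
  a polynomial with vanishing partial derivatives is constant.\<close>

lemma pd_kernel:
  fixes f :: "'a::field_char_0 exp_alg"
  assumes "f \<in> coeff_alg" and kernel: "\<And>t. t \<in> {1..n} \<Longrightarrow> pd m i t f = 0"
  shows "\<exists>c. f = single 0 c"
proof -
  have no_exp: "a = 0" if aj: "(a, j) \<in> keys f" for a j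
  proof (rule ccontr)
    assume "a \<noteq> 0"
    then have "keys a \<noteq> {}" by simp
    then obtain t l where "(t, l) \<in> keys a"
      by (metis ex_in_conv surj_pair)
    moreover have range: "keys a \<subseteq> (SIGMA s:{1..n}. {1..m s})"
      using aj \<open>f \<in> coeff_alg\<close> by (auto simp: coeff_alg_def monoms_def)
    ultimately have t: "t \<in> {1..n}" by auto
    define B where "B = {k. (t, k) \<in> keys a}"
    have "B \<subseteq> {1..m t}" "l \<in> B"
      using range \<open>(t, l) \<in> keys a\<close> by (auto simp: B_def)
    then have "finite B" "B \<noteq> {}"
      using finite_subset by auto
    define K where "K = Max B"
    have "K \<in> B" and K_max: "\<And>k. k \<in> B \<Longrightarrow> k \<le> K"
      using \<open>finite B\<close> \<open>B \<noteq> {}\<close> by (auto simp: K_def)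
    then have K: "K \<in> {1..m t}" "lookup a (t, K) \<noteq> 0"
      using \<open>B \<subseteq> {1..m t}\<close> by (auto simp: B_def in_keys_iff)
    define D where "D = (\<lambda>\<mu>. lookup (snd \<mu>) t) ` {\<mu> \<in> keys f. fst \<mu> = a}"
    have "finite D" "D \<noteq> {}"
      using aj by (auto simp: D_def)
    then have "Max D \<in> D"
      by (rule Max_in)
    then obtain j0 where j0: "(a, j0) \<in> keys f" "lookup j0 t = Max D"
      by (auto simp: D_def)
    have above: "lookup f (a, j') = 0" if "lookup j' t > lookup j0 t" for j'
    proof (rule ccontr)
      assume "lookup f (a, j') \<noteq> 0"
      then have "lookup j' t \<in> D"
        by (force simp: D_def in_keys_iff)
      with \<open>finite D\<close> that j0(2) show False
        by (simp add: leD)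
    qed
    \<comment> \<open>The exponent of the leading term of the derivative.\<close>
    let ?j = "j0 + single t (int (i t K) - 1)"
    have other: "of_int (lookup a (t, k)) * of_nat (i t k)
        * lookup f (a, ?j - single t (int (i t k) - 1)) = 0"
      if k: "k \<in> {1..m t} - {K}" for k
    proof (cases "k < K")
      case True
      then have "i t k < i t K"
        using k K strict_mono_onD[OF i_strict_mono[OF t]] by auto
      then have "lookup f (a, ?j - single t (int (i t k) - 1)) = 0"
        by (intro above) (simp add: lookup_add lookup_minus)
      then show ?thesis by simp
    next
      case False
      then have "lookup a (t, k) = 0"
        using K_max[of k] k by (auto simp: B_def in_keys_iff)
      then show ?thesis by simp
    qed
    have "0 = lookup (pd m i t f) (a, ?j)"
      by (simp only: kernel[OF t] lookup_zero)
    also have "\<dots> = of_int (lookup ?j t + 1) * lookup f (a, ?j + single t 1)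
      + of_int (lookup a (t, K)) * of_nat (i t K) * lookup f (a, ?j - single t (int (i t K) - 1))"
      unfolding lookup_pd sum.remove[OF finite_atLeastAtMost K(1)]
      by (simp only: sum.neutral[OF ballI, OF other] add_0_right)
    also have "lookup f (a, ?j + single t 1) = 0"
      using i_pos[OF t K(1)] by (intro above) (simp add: lookup_add)
    finally show False
      using K(2) i_pos[OF t K(1)] j0(1) by (simp add: in_keys_iff)
  qed
  have "\<mu> = 0" if \<mu>: "\<mu> \<in> keys f" for \<mu>
  proof -
    obtain a j where aj: "\<mu> = (a, j)" by (cases \<mu>)
    with \<mu> no_exp have a: "a = 0" by blast
    have "lookup j t = 0" for t
    proof (cases "t \<in> {1..n}")
      case True
      have "0 = lookup (pd m i t f) (0, j - single t 1)"
        by (simp only: kernel[OF True] lookup_zero)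
      also have "\<dots> = of_int (lookup j t) * lookup f (0, j)"
        unfolding lookup_pd by (simp add: lookup_minus)
      finally show ?thesis
        using \<mu> aj a by (simp add: in_keys_iff)
    next
      case False
      have "keys j \<subseteq> {1..n}"
        using \<mu> aj \<open>f \<in> coeff_alg\<close> by (auto simp: coeff_alg_def monoms_def)
      with False have "t \<notin> keys j" by blast
      then show ?thesis by (simp add: in_keys_iff)
    qed
    then show ?thesis
      by (simp add: aj a zero_prod_def poly_mapping_eqI)
  qed
  then have "keys f \<subseteq> {0}" by blast
  then have "f = single 0 (lookup f 0)"
    using sum_single_lookup[of "{0}" f] by simp
  then show ?thesis ..
qed

text \<open>The descent runs lexicographically over the number of exponential monomials of an element and, once the
  trivial one occurs among them, over a bound on the degree of the polynomial that goes with it.\<close>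

lemma one_in_pd_stable_ideal:
  fixes J :: "'a::field_char_0 exp_alg set"
  assumes JA: "J \<subseteq> coeff_alg"
    and J_mult: "\<And>b g. b \<in> coeff_alg \<Longrightarrow> g \<in> J \<Longrightarrow> b * g \<in> J"
    and J_pd: "\<And>t g. t \<in> {1..n} \<Longrightarrow> g \<in> J \<Longrightarrow> pd m i t g \<in> J"
    and "f \<in> J" "f \<noteq> 0"
  shows "1 \<in> J"
proof -
  \<comment> \<open>The exponential monomials that occur in \<open>g\<close>.\<close>
  define E where "E g = fst ` keys g" for g :: "'a exp_alg"
  define deg where "deg j = (\<Sum>s\<in>{1..n}. nat (lookup j s))" for j :: "nat \<Rightarrow>\<^sub>0 int"
  have finE: "finite (E g)" for g
    by (simp add: E_def)
  have E_pd: "E (pd m i t g) \<subseteq> E g" for t g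
  proof (clarsimp simp: E_def)
    fix a j assume "(a, j) \<in> keys (pd m i t g)"
    then have "lookup (pd m i t g) (a, j) \<noteq> 0"
      by (simp add: in_keys_iff)
    then have "\<exists>j'. lookup g (a, j') \<noteq> 0"
      unfolding lookup_pd by (rule contrapos_np) simp
    then show "a \<in> fst ` keys g"
      by (force simp: in_keys_iff)
  qed
  have deg_Suc: "deg (j + single t 1) = Suc (deg j)" if "t \<in> {1..n}" "0 \<le> lookup j t" for t j
    using that by (simp add: deg_def sum.remove[of _ t] lookup_add lookup_single when_def)
  have "1 \<in> J" if "g \<in> J" "g \<noteq> 0" "card (E g) = c" for g c
    using that
  proof (induction c arbitrary: g rule: less_induct)
    case (less c)
    have descend: "1 \<in> J" if "h \<in> J" "0 \<in> E h" "card (E h) \<le> c" "\<And>j. (0, j) \<in> keys h \<Longrightarrow> deg j \<le> r"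
      for h r
      using that
    proof (induction r arbitrary: h rule: less_induct)
      case (less r)
      have "h \<in> coeff_alg" using less.prems JA by auto
      show ?case
      proof (cases "\<exists>t\<in>{1..n}. pd m i t h \<noteq> 0")
        case True
        then obtain t where t: "t \<in> {1..n}" and nz: "pd m i t h \<noteq> 0" by blast
        let ?h = "pd m i t h"
        have "?h \<in> J" using t less.prems J_pd by blast
        show ?thesis
        proof (cases "0 \<in> E ?h")
          case True
          have lower: "deg j < r" if j: "(0, j) \<in> keys ?h" for j
          proof -
            have "lookup ?h (0, j) = of_int (lookup j t + 1) * lookup h (0, j + single t 1)"
              unfolding lookup_pd by simp
            with j have "(0, j + single t 1) \<in> keys h"
              by (auto simp: in_keys_iff)
            then have "deg (j + single t 1) \<le> r"
              by (rule less.prems(4))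
            moreover have "0 \<le> lookup j t"
              using j subsetD[OF JA \<open>?h \<in> J\<close>] by (auto simp: coeff_alg_def monoms_def)
            ultimately show ?thesis
              using deg_Suc[OF t, of j] by simp
          qed
          have "0 < r"
            using True lower by (fastforce simp: E_def)
          moreover have "card (E ?h) \<le> c"
            using card_mono[OF finE E_pd[of t h]] less.prems(3) by simp
          ultimately show ?thesis
            using lower by (intro less.IH[of "r - 1" ?h] \<open>?h \<in> J\<close> True) fastforce+
        next
          case False
          then have "E ?h \<subset> E h"
            using E_pd[of t h] less.prems(2) by blast
          then have "card (E ?h) < c"
            using less.prems(3) by (rule less_le_trans[OF psubset_card_mono[OF finE]])
          then show ?thesis
            using \<open>\<And>y g. y < c \<Longrightarrow> g \<in> J \<Longrightarrow> g \<noteq> 0 \<Longrightarrow> card (E g) = y \<Longrightarrow> 1 \<in> J\<close> \<open>?h \<in> J\<close> nz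
            by blast
        qed
      next
        case False
        then obtain e where h: "h = single 0 e"
          using pd_kernel[OF \<open>h \<in> coeff_alg\<close>] by blast
        with less.prems(2) have "e \<noteq> 0"
          by (auto simp: E_def)
        then have "1 = single 0 (1 / e) * h"
          by (simp add: h mult_single)
        then show ?thesis
          by (metis J_mult coeff_alg_single monoms_zero less.prems(1))
      qed
    qed
    have "keys g \<noteq> {}" using less.prems(2) by simp
    then obtain a j where aj: "(a, j) \<in> keys g"
      by (metis ex_in_conv surj_pair)
    \<comment> \<open>Exponential monomials are units, so one of them can be made trivial.\<close>
    let ?g = "single (- a, 0) 1 * g"
    have shift: "\<mu> \<in> keys ?g \<longleftrightarrow> \<mu> + (a, 0) \<in> keys g" for \<mu>
      by (simp add: in_keys_iff lookup_single_mult minus_prod_def plus_prod_def)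
    have "E ?g = (\<lambda>b. b - a) ` E g"
      unfolding E_def image_image
    proof (intro set_eqI iffI; clarsimp simp: shift)
      fix b l assume "(b + a, l) \<in> keys g"
      then show "b \<in> (\<lambda>x. fst x - a) ` keys g" by force
    next
      fix b l assume "(b, l) \<in> keys g"
      then have "(b - a, l) \<in> keys ?g" by (simp add: shift)
      then show "b - a \<in> fst ` keys ?g" by (rule rev_image_eqI) simp
    qed
    then have "card (E ?g) = c"
      using less.prems(3) by (simp add: card_image inj_on_def)
    moreover have "0 \<in> E ?g"
      unfolding E_def using aj by (intro rev_image_eqI[of "(0, j)"]) (simp_all add: shift)
    moreover have "(a, j) \<in> monoms"
      using aj less.prems(1) JA by (auto simp: coeff_alg_def)
    then have "(- a, 0) \<in> monoms"
      by (auto simp: monoms_def)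
    then have "?g \<in> J"
      using J_mult coeff_alg_single less.prems(1) by blast
    moreover have "deg j \<le> Max (deg ` snd ` keys ?g)" if "(0, j) \<in> keys ?g" for j
      using that by (intro Max_ge) (force intro: rev_image_eqI)+
    ultimately show ?case
      using descend[of ?g] by blast
  qed
  then show ?thesis
    using assms(4,5) by blast
qed

section \<open>The Lie algebra\<close>

text \<open>The coefficients in the basis are exactly the monomials in \<open>monoms\<close>, so the span consists of all fields
  whose components are arbitrary linear combinations of these monomials.\<close>

lemma W_eq: "W n m = {u :: 'a::field vfield. keys u \<subseteq> {1..n} \<and> (\<forall>t. lookup u t \<in> coeff_alg)}"
proof -
  have coeff: "(\<Prod>s=1..n. \<Prod>k=1..m s. e_pow s k (a s k)) * (\<Prod>s=1..n. x_pow s (int (j s))) =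
      (single (\<Sum>(s, k)\<in>(SIGMA s:{1..n}. {1..m s}). single (s, k) (a s k),
        \<Sum>s=1..n. single s (int (j s))) 1 :: 'a exp_alg)" for a j
  proof -
    have pair: "(\<Sum>x\<in>S. (F x, 0)) = (sum F S, 0)" "(\<Sum>y\<in>T. (0, G y)) = (0, sum G T)"
      for S T and F :: "'x \<Rightarrow> 'y::comm_monoid_add" and G :: "'z \<Rightarrow> 'u::comm_monoid_add"
      by (simp_all add: prod_eq_iff fst_sum snd_sum)
    show ?thesis
      by (simp add: e_pow_def x_pow_def prod_single mult_single pair sum.Sigma case_prod_unfold)
  qed
  have monom_eq: "\<exists>a j. \<mu> = (\<Sum>(s, k)\<in>(SIGMA s:{1..n}. {1..m s}). single (s, k) (a s k),
      \<Sum>s=1..n. single s (int (j s)))" if \<mu>: "\<mu> \<in> monoms" for \<mu>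
  proof -
    obtain b l where bl: "\<mu> = (b, l)" by (cases \<mu>)
    have "b = (\<Sum>(s, k)\<in>(SIGMA s:{1..n}. {1..m s}). single (s, k) (lookup b (s, k)))"
      using \<mu> sum_single_lookup[of "SIGMA s:{1..n}. {1..m s}" b]
      by (simp add: monoms_def bl case_prod_unfold)
    moreover have "l = (\<Sum>s=1..n. single s (int (nat (lookup l s))))"
      using \<mu> sum_single_lookup[of "{1..n}" l] by (simp add: monoms_def bl)
    ultimately show ?thesis
      unfolding bl by (intro exI[of _ "\<lambda>s k. lookup b (s, k)"] exI[of _ "\<lambda>s. nat (lookup l s)"]) simp
  qed
  have eq_monom: "(\<Sum>(s, k)\<in>(SIGMA s:{1..n}. {1..m s}). single (s, k) (a s k),
      \<Sum>s=1..n. single s (int (j s))) \<in> monoms" for a j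
  proof -
    have "keys (\<Sum>(s, k)\<in>(SIGMA s:{1..n}. {1..m s}). single (s, k) (a s k)) \<subseteq>
        (SIGMA s:{1..n}. {1..m s})"
      by (rule order_trans[OF Poly_Mapping.keys_sum]) (auto split: if_splits)
    moreover have "keys (\<Sum>s=1..n. single s (int (j s))) \<subseteq> {1..n}"
      by (rule order_trans[OF Poly_Mapping.keys_sum]) (auto split: if_splits)
    ultimately show ?thesis
      by (auto simp: monoms_def lookup_sum lookup_single when_def intro!: sum_nonneg)
  qed
  let ?R = "{u :: 'a vfield. keys u \<subseteq> {1..n} \<and> (\<forall>t. lookup u t \<in> coeff_alg)}"
  show ?thesis
  proof
    have "W_basis n m \<subseteq> ?R"
    proof
      fix u :: "'a vfield" assume "u \<in> W_basis n m"
      then obtain a j t where "t \<in> {1..n}"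
        and u: "u = single t (single (\<Sum>(s, k)\<in>(SIGMA s:{1..n}. {1..m s}). single (s, k) (a s k),
        \<Sum>s=1..n. single s (int (j s))) 1)"
        unfolding W_basis_def coeff by blast
      then show "u \<in> ?R"
        using coeff_alg_single[OF eq_monom, of _ _ "1::'a"] by (simp add: lookup_single when_def)
    qed
    moreover have "vf.subspace ?R"
    proof (rule vf.subspaceI)
      fix u v assume "u \<in> ?R" "v \<in> ?R"
      then show "u + v \<in> ?R"
        using Poly_Mapping.keys_add[of u v] by (simp add: lookup_add coeff_alg_add) blast
    next
      fix c :: 'a and u :: "'a vfield" assume "u \<in> ?R"
      moreover have "keys (vf_scale c u) \<subseteq> keys u"
        by (auto simp: in_keys_iff)
      ultimately show "vf_scale c u \<in> ?R"
        by (simp add: coeff_alg_scale) blast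
    qed simp
    ultimately show "W n m \<subseteq> ?R"
      unfolding W_def by (rule vf.span_minimal)
  next
    have "u \<in> W n m" if u: "keys u \<subseteq> {1..n}" "\<And>t. lookup u t \<in> coeff_alg" for u :: "'a vfield"
    proof -
      have "single t (single \<mu> (1::'a)) \<in> W_basis n m" if "t \<in> {1..n}" "\<mu> \<in> monoms" for t \<mu>
      proof -
        obtain a j where \<mu>: "\<mu> = (\<Sum>(s, k)\<in>(SIGMA s:{1..n}. {1..m s}). single (s, k) (a s k),
            \<Sum>s=1..n. single s (int (j s)))"
          using monom_eq[OF \<open>\<mu> \<in> monoms\<close>] by blast
        show ?thesis
          unfolding W_basis_def coeff mem_Collect_eq \<mu>
          by (rule exI[of _ a], rule exI[of _ j], rule exI[of _ t]) (simp only: that simp_thms)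
      qed
      then have monom: "single t (single \<mu> c) \<in> W n m" if "t \<in> {1..n}" "\<mu> \<in> monoms"
        for t \<mu> and c :: 'a
        using vf.span_scale[OF vf.span_base, of "single t (single \<mu> 1)" "W_basis n m" c] that
        by (simp add: W_def vf_scale_single alg_scale_eq_mult mult_single)
      have "single t (lookup u t) \<in> W n m" if t: "t \<in> {1..n}" for t
      proof -
        let ?f = "lookup u t"
        have "single t ?f = (\<Sum>\<mu>\<in>keys ?f. single t (single \<mu> (lookup ?f \<mu>)))"
        proof -
          have "single t (sum F S) = (\<Sum>x\<in>S. single t (F x))" for F :: "monom \<Rightarrow> 'a exp_alg" and S
            by (induction S rule: infinite_finite_induct) (simp_all add: single_add)
          from this[of "\<lambda>\<mu>. single \<mu> (lookup ?f \<mu>)" "keys ?f"] show ?thesis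
            by (simp only: sum_single_lookup[OF finite_keys order_refl])
        qed
        also have "\<dots> \<in> W n m"
          unfolding W_def using u(2)[of t] t monom
          by (intro vf.span_sum) (auto simp: coeff_alg_def W_def)
        finally show ?thesis .
      qed
      then have "(\<Sum>t\<in>{1..n}. single t (lookup u t)) \<in> W n m"
        unfolding W_def by (rule vf.span_sum)
      then show ?thesis
        using sum_single_lookup[OF _ u(1)] by simp
    qed
    then show "?R \<subseteq> W n m" by blast
  qed
qed

lemma single_in_W: "t \<in> {1..n} \<Longrightarrow> single t f \<in> W n m \<longleftrightarrow> f \<in> coeff_alg"
  by (auto simp: W_eq lookup_single when_def)

lemma vf_apply_in_coeff_alg:
  assumes "u \<in> W n m" "f \<in> coeff_alg"
  shows "vf_apply m i u f \<in> coeff_alg"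
  using assms unfolding vf_apply_def W_eq by (blast intro: coeff_alg_sum coeff_alg_mult coeff_alg_pd)

lemma vf_bracket_in_W:
  assumes "u \<in> W n m" "v \<in> W n m"
  shows "vf_bracket m i u v \<in> W n m"
proof -
  have "lookup u t \<in> coeff_alg" "lookup v t \<in> coeff_alg" for t
    using assms by (simp_all add: W_eq)
  then have "lookup (vf_bracket m i u v) t \<in> coeff_alg" for t
    unfolding lookup_vf_bracket using assms by (intro coeff_alg_diff vf_apply_in_coeff_alg)
  moreover have "keys (vf_bracket m i u v) \<subseteq> {1..n}"
  proof
    fix t assume "t \<in> keys (vf_bracket m i u v)"
    then have "lookup u t \<noteq> 0 \<or> lookup v t \<noteq> 0"
      by (auto simp: in_keys_iff lookup_vf_bracket)
    then show "t \<in> {1..n}"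
      using assms by (auto simp: W_eq in_keys_iff)
  qed
  ultimately show ?thesis
    by (simp add: W_eq)
qed

lemma lie_algebra_W: "lie_algebra (vf_scale :: 'a::field \<Rightarrow> _) (W n m) (vf_bracket m i)"
proof
  show "vf.subspace (W n m :: 'a vfield set)"
    by (simp add: W_def)
next
  fix x y z :: "'a vfield" and c
  show "vf_bracket m i (x + y) z = vf_bracket m i x z + vf_bracket m i y z"
    by (rule poly_mapping_eqI)
      (simp add: lookup_vf_bracket lookup_add vf_apply_add_left vf_apply_add_right)
  show "vf_bracket m i x (y + z) = vf_bracket m i x y + vf_bracket m i x z"
    by (rule poly_mapping_eqI)
      (simp add: lookup_vf_bracket lookup_add vf_apply_add_left vf_apply_add_right)
  show "vf_bracket m i (vf_scale c x) y = vf_scale c (vf_bracket m i x y)"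
    "vf_bracket m i x (vf_scale c y) = vf_scale c (vf_bracket m i x y)"
    by (rule poly_mapping_eqI, simp add: lookup_vf_bracket vf_apply_scale_left
        vf_apply_scale_right, simp add: alg_scale_eq_mult right_diff_distrib)+
  show "vf_bracket m i x x = 0"
    by (rule poly_mapping_eqI) (simp add: lookup_vf_bracket)
qed (simp_all add: vf_bracket_in_W vf_bracket_jacobi)

section \<open>Ideals\<close>

context
  fixes I :: "'a::field_char_0 vfield set"
  assumes I_subspace: "vf.subspace I"
    and I_W: "I \<subseteq> W n m"
    and I_bracket: "\<And>u v. u \<in> W n m \<Longrightarrow> v \<in> I \<Longrightarrow> vf_bracket m i u v \<in> I"
begin

lemmas I_add = vf.subspace_add[OF I_subspace]
  and I_diff = vf.subspace_diff[OF I_subspace]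
  and I_scale = vf.subspace_scale[OF I_subspace]

text \<open>With \<open>X = x\<^sub>p\<close> and \<open>'\<close> for \<open>\<partial>\<^sub>p\<close>, bracketing with \<open>c\<partial>\<^sub>p\<close>, where \<open>c\<close> is \<open>1\<close>, \<open>X\<close> or \<open>X\<^sup>2\<close>, sends a component \<open>f\<close> to \<open>cf'\<close>, and to
  \<open>cf' - c'f\<close> in the \<open>p\<close>-th place; other components do not interfere because \<open>c\<close> depends on \<open>x\<^sub>p\<close> only. The Casimir
  operator of \<open>sl\<^sub>2\<close> is a scalar on each of these two modules: \<open>0\<close> on functions and \<open>-4\<close>
  on vector fields of one variable.\<close>

lemma component_in_ideal:
  assumes u: "u \<in> I" and p: "p \<in> {1..n}"
  shows "single p (lookup u p) \<in> I"
proof -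
  define X :: "'a exp_alg" where "X = x_pow p 1"
  define ad where "ad c w = vf_bracket m i (single p c) w" for c and w :: "'a vfield"
  have pd_X: "pd m i t X = (if t = p then 1 else 0)" for t
    by (auto simp: X_def pd_x)
  have lookup_ad: "lookup (ad c w) q =
      c * pd m i p (lookup w q) - (if q = p then lookup w p * pd m i p c else 0)"
    if other: "\<And>t. t \<noteq> p \<Longrightarrow> pd m i t c = 0" for c w q
  proof -
    have "vf_apply m i w c = (\<Sum>t\<in>insert p (keys w). lookup w t * pd m i t c)"
      by (rule vf_apply_superset) auto
    also have "\<dots> = lookup w p * pd m i p c"
      by (subst sum.remove[of _ p]) (auto intro!: sum.neutral simp: other)
    finally show ?thesis
      by (auto simp: ad_def lookup_vf_bracket vf_apply_single lookup_single when_def)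
  qed
  have lookup_ad1: "lookup (ad 1 w) q = pd m i p (lookup w q)" for w q
    by (simp add: lookup_ad)
  have lookup_adX: "lookup (ad X w) q =
      X * pd m i p (lookup w q) - (if q = p then lookup w p else 0)" for w q
    by (simp add: lookup_ad pd_X)
  have lookup_adXX: "lookup (ad (X * X) w) q =
      X * X * pd m i p (lookup w q) - (if q = p then lookup w p * (X + X) else 0)" for w q
    by (simp add: lookup_ad pd_X pd_mult)
  \<comment> \<open>The Casimir operator, applied to \<open>u\<close>.\<close>
  let ?C = "ad 1 (ad (X * X) u) - (ad X (ad X u) + ad X (ad X u)) + ad (X * X) (ad 1 u)"
  have "X \<in> coeff_alg" unfolding X_def by (rule coeff_alg_x_pow) (use p in auto)
  then have ad_I: "ad 1 w \<in> I" "ad X w \<in> I" "ad (X * X) w \<in> I" if "w \<in> I" for w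
    using that p unfolding ad_def by (auto intro!: I_bracket coeff_alg_mult simp: single_in_W)
  have "?C \<in> I"
    using u by (intro I_add I_diff ad_I)
  moreover have "?C = vf_scale (- 4) (single p (lookup u p))"
  proof (rule poly_mapping_eqI)
    fix q
    have scale: "alg_scale 4 f = 4 * f" for f :: "'a exp_alg"
      by (rule poly_mapping_eqI) (simp add: lookup_numeral_mult)
    have "lookup ?C q = lookup (ad 1 (ad (X * X) u)) q
        - (lookup (ad X (ad X u)) q + lookup (ad X (ad X u)) q) + lookup (ad (X * X) (ad 1 u)) q"
      by (simp only: lookup_add lookup_minus)
    also have "\<dots> = (if q = p then - 4 * lookup u p else 0)"
      by (simp add: lookup_ad1 lookup_adX lookup_adXX pd_diff pd_mult pd_add pd_X algebra_simps)
    finally show "lookup ?C q = lookup (vf_scale (- 4) (single p (lookup u p))) q"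
      by (simp add: lookup_single when_def scale)
  qed
  ultimately have "vf_scale (- 1 / 4) (vf_scale (- 4) (single p (lookup u p))) \<in> I"
    using I_scale by metis
  then show ?thesis by simp
qed

context
  fixes p :: nat
  assumes p: "p \<in> {1..n}"
begin

definition ideal_part :: "'a exp_alg set" where
  "ideal_part = {h. single p h \<in> I}"

lemma ideal_part_in_coeff_alg: "h \<in> ideal_part \<Longrightarrow> h \<in> coeff_alg"
  using I_W p single_in_W by (auto simp: ideal_part_def)

lemma ideal_part_add: "g \<in> ideal_part \<Longrightarrow> h \<in> ideal_part \<Longrightarrow> g + h \<in> ideal_part"
  by (simp add: ideal_part_def single_add I_add)

lemma ideal_part_diff: "g \<in> ideal_part \<Longrightarrow> h \<in> ideal_part \<Longrightarrow> g - h \<in> ideal_part"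
  by (simp add: ideal_part_def single_diff I_diff)

lemma ideal_part_scale: "h \<in> ideal_part \<Longrightarrow> alg_scale c h \<in> ideal_part"
  using I_scale by (auto simp: ideal_part_def simp flip: vf_scale_single)

lemma ideal_part_pd:
  assumes "h \<in> ideal_part" "t \<in> {1..n}"
  shows "pd m i t h \<in> ideal_part"
proof -
  have "vf_bracket m i (single t 1) (single p h) \<in> I"
    using assms by (intro I_bracket) (auto simp: ideal_part_def single_in_W)
  then show ?thesis
    by (simp add: ideal_part_def vf_bracket_single)
qed

lemma ideal_part_wronskian:
  assumes "h \<in> ideal_part" "b \<in> coeff_alg"
  shows "b * pd m i p h - h * pd m i p b \<in> ideal_part"
proof -
  have "vf_bracket m i (single p b) (single p h) \<in> I"
    using assms p by (intro I_bracket) (auto simp: ideal_part_def single_in_W)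
  then show ?thesis
    by (simp add: ideal_part_def vf_bracket_single single_diff)
qed

text \<open>The Wronskians of \<open>xk\<close> with \<open>b\<close> and of \<open>k\<close> with \<open>xb\<close> both have \<open>x(bk' - kb')\<close> as their part of first order, so their
  difference is a multiple of \<open>bk\<close>, namely \<open>2bk\<close>.\<close>

lemma ideal_part_absorbs:
  assumes k: "k \<in> ideal_part" "x_pow p 1 * k \<in> ideal_part" and b: "b \<in> coeff_alg"
  shows "b * k \<in> ideal_part"
proof -
  let ?X = "x_pow p 1 :: 'a exp_alg" and ?d = "pd m i p :: 'a exp_alg \<Rightarrow> _"
  have "?X \<in> coeff_alg" by (rule coeff_alg_x_pow) (use p in auto)
  then have "(b * ?d (?X * k) - ?X * k * ?d b) - (?X * b * ?d k - k * ?d (?X * b)) \<in> ideal_part"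
    using assms by (intro ideal_part_diff ideal_part_wronskian coeff_alg_mult)
  also have "(b * ?d (?X * k) - ?X * k * ?d b) - (?X * b * ?d k - k * ?d (?X * b)) = b * k + b * k"
    by (simp add: pd_mult pd_x algebra_simps)
  finally have "alg_scale (1 / 2) (b * k + b * k) \<in> ideal_part"
    by (rule ideal_part_scale)
  also have "alg_scale (1 / 2) (b * k + b * k) = b * k"
    by (rule poly_mapping_eqI) (simp add: lookup_numeral_mult)
  finally show ?thesis .
qed

text \<open>Both \<open>h''\<close> and \<open>xh''\<close> arise from \<open>h\<close>: the latter as the Wronskian of \<open>h'\<close> with \<open>x\<close>, corrected by \<open>h'\<close>.\<close>

lemma ideal_part_second_pd:
  assumes h: "h \<in> ideal_part" and b: "b \<in> coeff_alg"
  shows "b * pd m i p (pd m i p h) \<in> ideal_part"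
proof (rule ideal_part_absorbs[OF _ _ b])
  let ?X = "x_pow p 1 :: 'a exp_alg" and ?d = "pd m i p :: 'a exp_alg \<Rightarrow> _"
  have X: "?X \<in> coeff_alg" by (rule coeff_alg_x_pow) (use p in auto)
  show "?d (?d h) \<in> ideal_part"
    using h p by (intro ideal_part_pd)
  have "(?X * ?d (?d h) - ?d h * ?d ?X) + ?d h \<in> ideal_part"
    using h p X by (intro ideal_part_add ideal_part_wronskian ideal_part_pd)
  then show "?X * ?d (?d h) \<in> ideal_part"
    by (simp add: pd_x)
qed

text \<open>If \<open>h'' = 0\<close>, then the Wronskian \<open>x\<^sup>3h' - 3x\<^sup>2h\<close> has second derivative \<open>-6(h + xh')\<close>. If that is zero
  as well, differentiating once more gives \<open>2h' = 0\<close>, and then \<open>h = 0\<close>.\<close>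

lemma ideal_part_exists_second_pd_nonzero:
  assumes h: "h \<in> ideal_part" "h \<noteq> 0"
  shows "\<exists>g\<in>ideal_part. pd m i p (pd m i p g) \<noteq> 0"
proof (rule ccontr)
  assume "\<not> ?thesis"
  then have zero: "pd m i p (pd m i p g) = 0" if "g \<in> ideal_part" for g
    using that by blast
  let ?X = "x_pow p 1 :: 'a exp_alg" and ?d = "pd m i p :: 'a exp_alg \<Rightarrow> _"
  have X: "?X \<in> coeff_alg" by (rule coeff_alg_x_pow) (use p in auto)
  let ?g = "?X * ?X * ?X * ?d h - h * ?d (?X * ?X * ?X)"
  have "?g \<in> ideal_part"
    using h X by (intro ideal_part_wronskian coeff_alg_mult)
  have "- (6 * (h + ?X * ?d h)) = ?d (?d ?g)"
    using zero[OF h(1)] by (simp add: pd_uminus pd_diff pd_mult pd_add pd_x algebra_simps)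
  also have "\<dots> = 0"
    using \<open>?g \<in> ideal_part\<close> by (rule zero)
  finally have "6 * (h + ?X * ?d h) = 0"
    by (simp only: neg_equal_0_iff_equal)
  then have eq: "h + ?X * ?d h = 0"
    by (rule numeral_mult_eq_0)
  then have "?d (h + ?X * ?d h) = 0" by simp
  then have "2 * ?d h = 0"
    using zero[OF h(1)] by (simp add: pd_add pd_mult pd_x)
  then have "?d h = 0"
    by (rule numeral_mult_eq_0)
  with eq h(2) show False by simp
qed

lemma coeff_alg_subset_ideal_part:
  assumes h: "h \<in> ideal_part" "h \<noteq> 0"
  shows "coeff_alg \<subseteq> ideal_part"
proof -
  \<comment> \<open>The largest ideal of the coefficient algebra inside \<open>ideal_part\<close>.\<close>
  define J where "J = {g \<in> coeff_alg. \<forall>b\<in>coeff_alg. b * g \<in> ideal_part}"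
  obtain g where g: "g \<in> ideal_part" "pd m i p (pd m i p g) \<noteq> 0"
    using ideal_part_exists_second_pd_nonzero[OF h] by blast
  have "1 \<in> J"
  proof (rule one_in_pd_stable_ideal)
    show "J \<subseteq> coeff_alg" by (auto simp: J_def)
    show "b * g \<in> J" if "b \<in> coeff_alg" "g \<in> J" for b g
      using that by (simp add: J_def coeff_alg_mult flip: mult.assoc)
    show "pd m i t g \<in> J" if t: "t \<in> {1..n}" and g: "g \<in> J" for t g
    proof -
      have "b * pd m i t g \<in> ideal_part" if b: "b \<in> coeff_alg" for b
      proof -
        have "pd m i t (b * g) - pd m i t b * g \<in> ideal_part"
          using b t g by (intro ideal_part_diff ideal_part_pd) (auto simp: J_def coeff_alg_pd)
        then show ?thesis by (simp add: pd_mult)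
      qed
      then show ?thesis
        using t g by (simp add: J_def coeff_alg_pd)
    qed
    show "pd m i p (pd m i p g) \<in> J"
      using g(1) p ideal_part_second_pd by (simp add: J_def coeff_alg_pd ideal_part_in_coeff_alg)
  qed (rule g(2))
  then show ?thesis
    by (auto simp: J_def)
qed

end

lemma ideal_eq_zero_or_W: "I = {0} \<or> I = W n m"
proof (rule disjCI)
  assume "I \<noteq> W n m"
  show "I = {0}"
  proof (rule ccontr)
    assume "I \<noteq> {0}"
    then obtain u where u: "u \<in> I" "u \<noteq> 0"
      using vf.subspace_0[OF I_subspace] by blast
    then have "keys u \<noteq> {}" by simp
    then obtain p where p_key: "p \<in> keys u" by blast
    have "keys u \<subseteq> {1..n}"
      using subsetD[OF I_W u(1)] by (simp add: W_eq)
    with p_key have p: "p \<in> {1..n}" by blast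
    have ideal_part_nonzero: "lookup u p \<in> ideal_part p" "lookup u p \<noteq> 0"
      using component_in_ideal[OF u(1) p] p_key by (simp_all add: ideal_part_def[OF p] in_keys_iff)
    have in_I_p: "single p a \<in> I" if "a \<in> coeff_alg" for a
      using subsetD[OF coeff_alg_subset_ideal_part[OF p ideal_part_nonzero] that] by (simp add: ideal_part_def[OF p])
    have in_I_q: "single q a \<in> I" if q: "q \<in> {1..n}" and a: "a \<in> coeff_alg" for q a
    proof (cases "q = p")
      case False
      let ?X = "x_pow p 1 :: 'a exp_alg"
      have X: "?X \<in> coeff_alg" by (rule coeff_alg_x_pow) (use p in auto)
      have "single p (?X * pd m i q a) \<in> I"
        using X q a by (intro in_I_p coeff_alg_mult coeff_alg_pd)
      moreover have "vf_bracket m i (single q ?X) (single p a) \<in> I"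
        using X q a by (intro I_bracket in_I_p) (simp_all add: single_in_W)
      ultimately have "single p (?X * pd m i q a) - vf_bracket m i (single q ?X) (single p a) \<in> I"
        by (rule I_diff)
      then show ?thesis
        by (simp add: vf_bracket_single pd_x)
    qed (use a in_I_p in simp)
    have "v \<in> I" if "v \<in> W n m" for v
    proof -
      have v: "keys v \<subseteq> {1..n}" "\<And>t. lookup v t \<in> coeff_alg"
        using that by (auto simp: W_eq)
      have "(\<Sum>t\<in>{1..n}. single t (lookup v t)) \<in> I"
        using v by (intro vf.subspace_sum[OF I_subspace] in_I_q)
      then show ?thesis
        using sum_single_lookup[OF _ v(1)] by simp
    qed
    with I_W \<open>I \<noteq> W n m\<close> show False by blast
  qed
qed

end

end

theorem theorem1:
  fixes n :: nat and m :: "nat \<Rightarrow> nat" and i :: "nat \<Rightarrow> nat \<Rightarrow> nat"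
  assumes "n \<ge> 1"
    and "\<And>s k. s \<in> {1..n} \<Longrightarrow> k \<in> {1..m s} \<Longrightarrow> i s k > 0"
    and "\<And>s. s \<in> {1..n} \<Longrightarrow> strict_mono_on {1..m s} (i s)"
  shows "simple_lie_algebra (vf_scale :: 'a::field_char_0 \<Rightarrow> 'a vfield \<Rightarrow> 'a vfield)
           (W n m) (vf_bracket m i)"
proof -
  interpret exp_generators n m i
    by unfold_locales (use assms in auto)
  interpret L: lie_algebra "vf_scale :: 'a \<Rightarrow> 'a vfield \<Rightarrow> 'a vfield" "W n m" "vf_bracket m i"
    by (rule lie_algebra_W)
  show ?thesis
  proof
    have 1: "1 \<in> {1..n}" using assms(1) by simp
    then have "single 1 1 \<in> (W n m :: 'a vfield set)" "single 1 (x_pow 1 1) \<in> (W n m :: 'a vfield set)"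
      by (simp_all only: single_in_W coeff_alg_one coeff_alg_x_pow zero_le_one)
    moreover have "lookup (vf_bracket m i (single 1 1) (single 1 (x_pow 1 1))) 1 = (1 :: 'a exp_alg)"
      by (simp add: vf_bracket_single pd_x)
    then have "vf_bracket m i (single 1 1) (single 1 (x_pow 1 1)) \<noteq> (0 :: 'a vfield)"
      by auto
    ultimately show "\<exists>x\<in>W n m. \<exists>y\<in>W n m. vf_bracket m i x y \<noteq> (0 :: 'a vfield)"
      by blast
  next
    fix I :: "'a vfield set"
    assume "L.lie_ideal I"
    then show "I = {0} \<or> I = W n m"
      unfolding L.lie_ideal_def by (intro ideal_eq_zero_or_W) auto
  qed
qed

end
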